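(* Let $A,B$ be standard Borel spaces. If the $B$-valued process $Y=(Y_i)_{i\in\mathbb{Z}}$ is a left finitary coding, with coding map $\varphi$, of an i.i.d. $A$-valued process $X=(X_i)_{i\in\mathbb{Z}}$, then for every local function $f:B^{\mathbb{Z}}\to\mathbb{R}$ satisfying the bounded-difference property, $$\log \mathbb{E}\big[\exp\{\lambda(f(Y)-\mathbb{E} f(Y))\}\big]\le 3\lambda^2\big(\mathbb{E}[2r_\varphi^-(X)+1]\big)^2\|\delta f\|_2^2,\qquad\forall\,\lambda>0.$$
   Context: $Y=\varphi(X)$ is a coding of $X$ if $\varphi:A^{\mathbb{Z}}\to B^{\mathbb{Z}}$ is measurable and commutes with the shifts. The left coding radius at the origin is $$r_\varphi^-(x)=\inf\{r\in\mathbb{N}_0:\ \forall y\in A^{\mathbb{Z}},\ (y_{-r},\dots,y_0)=(x_{-r},\dots,x_0)\Rightarrow\varphi(y)_0=\varphi(x)_0\}\in\mathbb{N}_0\cup\{\infty\}.$$ $Y$ is a left finitary coding of $X$ if $r_\varphi^-(X)<\infty$ almost surely. For measurable $f:B^{\mathbb{Z}}\to\mathbb{R}$, $\delta_jf=\sup\{|f(y)-f(y')|:y_\ell=y'_\ell\ \forall\ell\ne j\}$; $f$ is local if it depends on finitely many coordinates; it has the bounded-difference property if $\delta_jf<\infty$ for all $j$; $\|\delta f\|_2^2=\sum_j(\delta_jf)^2$. *)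

theory Defs
  imports "HOL-Probability.Probability"
begin

text \<open>Only the measurable-space part of the measures \<open>A\<close>, \<open>B\<close> below is used.\<close>

definition standard_borel :: "'a measure \<Rightarrow> bool" where
  "standard_borel A \<longleftrightarrow>
     (\<exists>T. completely_metrizable_space T \<and> separable_space T \<and> topspace T = space A \<and>
          sets A = sigma_sets (space A) {U. openin T U})"

abbreviation seq_space :: "'a measure \<Rightarrow> (int \<Rightarrow> 'a) measure" where
  "seq_space A \<equiv> Pi\<^sub>M UNIV (\<lambda>_. A)"

definition shift :: "(int \<Rightarrow> 'a) \<Rightarrow> int \<Rightarrow> 'a" where
  "shift x = (\<lambda>i. x (i + 1))"

definition iid_process :: "'w measure \<Rightarrow> 'a measure \<Rightarrow> (int \<Rightarrow> 'w \<Rightarrow> 'a) \<Rightarrow> bool" where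
  "iid_process M A X \<longleftrightarrow>
     prob_space.indep_vars M (\<lambda>_. A) X UNIV \<and> (\<forall>i j. distr M A (X i) = distr M A (X j))"

definition coding_map :: "'a measure \<Rightarrow> 'b measure \<Rightarrow> ((int \<Rightarrow> 'a) \<Rightarrow> int \<Rightarrow> 'b) \<Rightarrow> bool" where
  "coding_map A B \<phi> \<longleftrightarrow>
     \<phi> \<in> measurable (seq_space A) (seq_space B) \<and>
     (\<forall>x \<in> space (seq_space A). \<phi> (shift x) = shift (\<phi> x))"

text \<open>The infimum of the empty set is \<open>\<infinity>\<close> in \<^typ>\<open>enat\<close>.\<close>

definition left_radius :: "'a measure \<Rightarrow> ((int \<Rightarrow> 'a) \<Rightarrow> int \<Rightarrow> 'b) \<Rightarrow> (int \<Rightarrow> 'a) \<Rightarrow> enat" where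
  "left_radius A \<phi> x =
     Inf {enat r | r. \<forall>y \<in> space (seq_space A).
                        (\<forall>i \<in> {- int r..0}. y i = x i) \<longrightarrow> \<phi> y 0 = \<phi> x 0}"

text \<open>As usual for random variables, the equality \<open>Y = \<phi>(X)\<close> is an almost sure one.\<close>

definition left_finitary_coding ::
  "'w measure \<Rightarrow> 'a measure \<Rightarrow> 'b measure \<Rightarrow> ((int \<Rightarrow> 'a) \<Rightarrow> int \<Rightarrow> 'b) \<Rightarrow>
    (int \<Rightarrow> 'w \<Rightarrow> 'a) \<Rightarrow> (int \<Rightarrow> 'w \<Rightarrow> 'b) \<Rightarrow> bool" where
  "left_finitary_coding M A B \<phi> X Y \<longleftrightarrow>
     coding_map A B \<phi> \<and>
     (AE \<omega> in M. (\<lambda>i. Y i \<omega>) = \<phi> (\<lambda>i. X i \<omega>)) \<and>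
     (AE \<omega> in M. left_radius A \<phi> (\<lambda>i. X i \<omega>) < \<infinity>)"

definition local_function :: "'b measure \<Rightarrow> ((int \<Rightarrow> 'b) \<Rightarrow> real) \<Rightarrow> bool" where
  "local_function B f \<longleftrightarrow>
     (\<exists>J. finite J \<and> (\<forall>y \<in> space (seq_space B). \<forall>y' \<in> space (seq_space B).
                        (\<forall>j \<in> J. y j = y' j) \<longrightarrow> f y = f y'))"

definition osc :: "'b measure \<Rightarrow> ((int \<Rightarrow> 'b) \<Rightarrow> real) \<Rightarrow> int \<Rightarrow> ennreal" where
  "osc B f j = Sup {ennreal \<bar>f y - f y'\<bar> | y y'.
     y \<in> space (seq_space B) \<and> y' \<in> space (seq_space B) \<and> (\<forall>l. l \<noteq> j \<longrightarrow> y l = y' l)}"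

definition bounded_differences :: "'b measure \<Rightarrow> ((int \<Rightarrow> 'b) \<Rightarrow> real) \<Rightarrow> bool" where
  "bounded_differences B f \<longleftrightarrow> (\<forall>j. osc B f j < \<infinity>)"

definition osc_norm_sq :: "'b measure \<Rightarrow> ((int \<Rightarrow> 'b) \<Rightarrow> real) \<Rightarrow> ennreal" where
  "osc_norm_sq B f = (\<Sum>\<^sub>\<infinity>j \<in> UNIV. (osc B f j)\<^sup>2)"

text \<open>
  The set where the radius is at most \<open>n\<close> is co-analytic but in general not Borel, so the radius
  is measurable only with respect to the completion of the underlying probability measure.
\<close>

definition mean_left_window ::
  "'w measure \<Rightarrow> 'a measure \<Rightarrow> ((int \<Rightarrow> 'a) \<Rightarrow> int \<Rightarrow> 'b) \<Rightarrow> (int \<Rightarrow> 'w \<Rightarrow> 'a) \<Rightarrow> ennreal" where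
  "mean_left_window M A \<phi> X =
     (\<integral>\<^sup>+\<omega>. 2 * ennreal_of_enat (left_radius A \<phi> (\<lambda>i. X i \<omega>)) + 1 \<partial>completion M)"

end

theory Submission
  imports Defs
begin

text \<open>
  Reveal the coordinates of \<open>X\<close> from left to right and apply Azuma's argument to
  \<open>F(X) = f(\<phi>(X))\<close>. Resampling \<open>X\<^sub>i\<close> leaves \<open>Y\<^sub>j\<close> unchanged for \<open>j < i\<close>, and for \<open>j \<ge> i\<close> it can
  change \<open>Y\<^sub>j\<close> only if \<open>X\<^bsub>i+1\<^esub>, \<dots>, X\<^sub>j\<close> do not determine \<open>Y\<^sub>j\<close>. That event is independent of
  \<open>X\<^sub>l\<close>, \<open>l \<le> i\<close>, so the \<open>i\<close>-th martingale difference is bounded by the constant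
  \<open>\<Sum>\<^bsub>j\<ge>i\<^esub> \<delta>\<^sub>jf \<cdot> q\<^bsub>j-i\<^esub>\<close>, where \<open>q\<^sub>k \<le> P(r \<ge> k)\<close>. As \<open>\<Sum>\<^sub>k q\<^sub>k \<le> E[r + 1]\<close>, Young's convolution
  inequality gives the bound, even with constant \<open>1/2\<close> in place of \<open>3\<close>.
\<close>

subsection \<open>Almost surely determined coordinates of a coding\<close>

text \<open>For distinct \<open>x\<close> and \<open>y\<close>, some ball with centre in a countable
  dense set and rational radius below half their distance contains \<open>x\<close> but not
  \<open>y\<close>. So the complement of the diagonal is a countable union of measurable
  rectangles.\<close>

lemma standard_borel_pred_eq:
  assumes "standard_borel B"
  shows "Measurable.pred (B \<Otimes>\<^sub>M B) (\<lambda>p. fst p = snd p)"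
proof -
  obtain T where T: "completely_metrizable_space T" "separable_space T" "topspace T = space B"
      "sets B = sigma_sets (space B) {U. openin T U}"
    using assms by (auto simp: standard_borel_def)
  then obtain S d where S: "Metric_space S d" and TS: "T = Metric_space.mtopology S d"
    by (metis completely_metrizable_imp_metrizable_space metrizable_space_def)
  interpret Metric_space S d by fact
  have space_B: "space B = S"
    using T(3) TS by simp
  obtain D where D: "countable D" "D \<subseteq> S" "mtopology closure_of D = S"
    using T(2) unfolding separable_space_def TS by auto
  have ball: "mball q r \<in> sets B" for q r
    unfolding T(4) by (rule sigma_sets.Basic) (simp add: TS)
  have "{p \<in> space (B \<Otimes>\<^sub>M B). \<not> fst p = snd p}
      = (\<Union>q\<in>D. \<Union>r\<in>\<rat>. mball q r \<times> (space B - mball q r))" (is "?L = ?R")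
  proof
    show "?L \<subseteq> ?R"
    proof
      fix p assume "p \<in> ?L"
      then obtain x y where p: "p = (x, y)" and xy: "x \<in> S" "y \<in> S" "x \<noteq> y"
        by (cases p) (auto simp: space_pair_measure space_B)
      from xy have "0 < d x y / 2"
        by simp
      moreover have "x \<in> mtopology closure_of D"
        using D(3) xy by simp
      ultimately obtain q where q: "q \<in> D" "d x q < d x y / 2"
        unfolding metric_closure_of in_mball by blast
      then obtain r where r: "r \<in> \<rat>" "d x q < r" "r < d x y / 2"
        using Rats_dense_in_real by blast
      have "q \<in> S"
        using q D by auto
      have "d x y \<le> d x q + d q y"
        using triangle xy \<open>q \<in> S\<close> by blast
      with r have "\<not> d q y < r"
        by linarith
      then show "p \<in> ?R"
        using q r xy \<open>q \<in> S\<close> by (auto simp: p space_B commute intro!: bexI[of _ q] bexI[of _ r])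
    qed
  qed (auto simp: space_pair_measure space_B)
  moreover have "?R \<in> sets (B \<Otimes>\<^sub>M B)"
    using D(1) by (auto intro!: sets.countable_UN' pair_measureI ball simp: countable_rat)
  ultimately have "Measurable.pred (B \<Otimes>\<^sub>M B) (\<lambda>p. \<not> fst p = snd p)"
    by (simp add: pred_def)
  then show ?thesis
    using pred_intros_logic(2)[of "\<lambda>p. \<not> fst p = snd p"] by simp
qed

text \<open>The process is replaced by its law: \<open>N\<close> is to be the law of a single
  \<open>X i\<close>. Standardness of \<open>B\<close> enters only as measurability of the
  diagonal.\<close>

locale iid_coding = N: prob_space N for N :: "'a measure" +
  fixes B :: "'b measure" and \<phi> :: "(int \<Rightarrow> 'a) \<Rightarrow> int \<Rightarrow> 'b"
  assumes coding_measurable [measurable]: "\<phi> \<in> seq_space N \<rightarrow>\<^sub>M seq_space B"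
    and coding_shift: "\<And>x. x \<in> space (seq_space N) \<Longrightarrow> \<phi> (shift x) = shift (\<phi> x)"
    and pred_eq: "Measurable.pred (B \<Otimes>\<^sub>M B) (\<lambda>p. fst p = snd p)"
begin

abbreviation P :: "(int \<Rightarrow> 'a) measure" where
  "P \<equiv> seq_space N"

sublocale product_prob_space "\<lambda>_::int. N" UNIV
  by unfold_locales

sublocale PP: pair_prob_space P P
  by unfold_locales

section \<open>Splicing independent samples\<close>

lemma override_on_in_space [simp]:
  "w \<in> space P \<Longrightarrow> x \<in> space P \<Longrightarrow> override_on w x S \<in> space P"
  by (auto simp: space_PiM override_on_def PiE_iff)

lemma override_on_measurable:
  "(\<lambda>z. override_on (fst z) (snd z) S) \<in> P \<Otimes>\<^sub>M P \<rightarrow>\<^sub>M P"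
proof (rule measurable_PiM_single')
  fix i
  show "(\<lambda>z. override_on (fst z) (snd z) S i) \<in> P \<Otimes>\<^sub>M P \<rightarrow>\<^sub>M N"
    by (cases "i \<in> S") simp_all
qed (auto simp: space_pair_measure space_PiM override_on_def PiE_iff)

lemma override_on_measurable' [measurable (raw)]:
  assumes "g \<in> Q \<rightarrow>\<^sub>M P" "h \<in> Q \<rightarrow>\<^sub>M P"
  shows "(\<lambda>z. override_on (g z) (h z) S) \<in> Q \<rightarrow>\<^sub>M P"
  using measurable_compose[OF measurable_Pair[OF assms] override_on_measurable] by simp

text \<open>\<open>override_on w x S\<close> keeps \<open>x\<close> on \<open>S\<close> and takes
  fresh values from \<open>w\<close> elsewhere. The preimage of a cylinder is a rectangle whose
  sides constrain \<open>J - S\<close> and \<open>J \<inter> S\<close>, so the product formula is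
  recovered.\<close>

lemma distr_override_on:
  "distr (P \<Otimes>\<^sub>M P) P (\<lambda>z. override_on (fst z) (snd z) S) = P"
proof (rule PiM_eq)
  fix J :: "int set" and F
  assume J: "finite J" and F: "\<And>j. j \<in> J \<Longrightarrow> F j \<in> sets N"
  let ?E = "\<lambda>J. prod_emb UNIV (\<lambda>_. N) J (Pi\<^sub>E J F)"
  have E [measurable]: "?E K \<in> sets P" if "K \<subseteq> J" for K
    using that J F by (intro sets_PiM_I) (auto intro: finite_subset)
  have "emeasure (distr (P \<Otimes>\<^sub>M P) P (\<lambda>z. override_on (fst z) (snd z) S)) (?E J)
      = emeasure (P \<Otimes>\<^sub>M P) ((\<lambda>z. override_on (fst z) (snd z) S) -` ?E J \<inter> space (P \<Otimes>\<^sub>M P))"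
    by (rule emeasure_distr) (use E in simp_all)
  also have "(\<lambda>z. override_on (fst z) (snd z) S) -` ?E J \<inter> space (P \<Otimes>\<^sub>M P)
      = ?E (J - S) \<times> ?E (J \<inter> S)"
    by (auto simp: prod_emb_def space_pair_measure space_PiM override_on_def PiE_iff split: if_splits)
  also have "emeasure (P \<Otimes>\<^sub>M P) \<dots> = emeasure P (?E (J - S)) * emeasure P (?E (J \<inter> S))"
    by (rule emeasure_pair_measure_Times) (auto intro: E)
  also have "\<dots> = (\<Prod>j\<in>J - S. emeasure N (F j)) * (\<Prod>j\<in>J \<inter> S. emeasure N (F j))"
    using J F by (subst (1 2) emeasure_PiM_emb) auto
  also have "\<dots> = (\<Prod>j\<in>J. emeasure N (F j))"
    using prod.Int_Diff[OF J, of "\<lambda>j. emeasure N (F j)" S] by (simp add: mult.commute)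
  finally show "emeasure (distr (P \<Otimes>\<^sub>M P) P (\<lambda>z. override_on (fst z) (snd z) S)) (?E J)
      = (\<Prod>j\<in>J. emeasure N (F j))" .
qed simp

text \<open>For fixed \<open>x\<close> the condition says that the indicator of its failure has
  integral zero, and that integral is measurable in \<open>x\<close>. The nested almost sure
  quantifiers in \<open>determined\<close> rely on this.\<close>

lemma pred_AE [measurable (raw)]:
  assumes [measurable]: "Measurable.pred (Q \<Otimes>\<^sub>M P) (case_prod R)"
  shows "Measurable.pred Q (\<lambda>x. AE y in P. R x y)"
proof -
  have "(AE y in P. R x y) \<longleftrightarrow> (\<integral>\<^sup>+y. of_bool (\<not> R x y) \<partial>P) = 0" if "x \<in> space Q" for x
  proof -
    have [measurable]: "Measurable.pred P (R x)"
      using measurable_compose[OF measurable_Pair1'[OF that] assms] by simp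
    show ?thesis
      by (subst nn_integral_0_iff_AE) auto
  qed
  then have "Measurable.pred Q (\<lambda>x. AE y in P. R x y) \<longleftrightarrow>
      Measurable.pred Q (\<lambda>x. (\<integral>\<^sup>+y. of_bool (\<not> R x y) \<partial>P) = 0)"
    by (rule measurable_cong)
  also have \<dots>
    by measurable
  finally show ?thesis .
qed

text \<open>
  Being almost surely unaffected by the coordinates outside \<open>S\<close> is a measurable condition, unlike a
  bound on the coding radius, and it is implied by such a bound.
\<close>

definition determined :: "int set \<Rightarrow> int \<Rightarrow> (int \<Rightarrow> 'a) set" where
  "determined S j = {z \<in> space P. AE u in P. AE v in P.
     \<phi> (override_on u z S) j = \<phi> (override_on v z S) j}"

lemma pred_coding_eq [measurable (raw)]:
  assumes [measurable]: "g \<in> Q \<rightarrow>\<^sub>M P" "h \<in> Q \<rightarrow>\<^sub>M P"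
  shows "Measurable.pred Q (\<lambda>z. \<phi> (g z) j = \<phi> (h z) j)"
proof -
  have "(\<lambda>z. (\<phi> (g z) j, \<phi> (h z) j)) \<in> Q \<rightarrow>\<^sub>M B \<Otimes>\<^sub>M B"
    by measurable
  from measurable_compose[OF this pred_eq] show ?thesis
    by simp
qed

lemma sets_determined [measurable]: "determined S j \<in> sets P"
  unfolding determined_def by measurable

lemma determined_cong:
  assumes "z \<in> space P" "z' \<in> space P" "\<And>i. i \<in> S \<Longrightarrow> z i = z' i"
  shows "z \<in> determined S j \<longleftrightarrow> z' \<in> determined S j"
proof -
  have "override_on u z S = override_on u z' S" for u
    using assms(3) by (auto simp: override_on_def)
  then show ?thesis
    using assms by (simp add: determined_def)
qed

text \<open>Splicing preserves \<open>P\<close>, so the property holds for almost every pair; Fubini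
  turns this into iterated quantifiers.\<close>

lemma AE_override_on:
  assumes [measurable]: "Measurable.pred P Q" and "AE x in P. Q x"
  shows "AE z in P. AE u in P. Q (override_on u z S)"
proof -
  have "AE z in distr (P \<Otimes>\<^sub>M P) P (\<lambda>z. override_on (fst z) (snd z) S). Q z"
    unfolding distr_override_on by fact
  then have *: "AE z in P \<Otimes>\<^sub>M P. Q (override_on (fst z) (snd z) S)"
    by (rule AE_distrD[OF override_on_measurable])
  have "AE u in P. AE z in P. Q (override_on u z S)"
    using PP.AE_pair[OF *] by simp
  then show ?thesis
    by (subst PP.AE_commute) simp_all
qed

text \<open>The converse: an almost sure property may be checked with the coordinates in
  \<open>S\<close> frozen and the others resampled.\<close>

lemma AE_override_onD:
  assumes [measurable]: "Measurable.pred P Q" and "AE z in P. AE u in P. Q (override_on u z S)"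
  shows "AE x in P. Q x"
proof -
  have "AE u in P. AE z in P. Q (override_on u z S)"
    using assms(2) by (subst PP.AE_commute) simp_all
  then have "AE z in P \<Otimes>\<^sub>M P. Q (override_on (fst z) (snd z) S)"
    by (intro PP.AE_pair_measure) simp_all
  then have "AE z in distr (P \<Otimes>\<^sub>M P) P (\<lambda>z. override_on (fst z) (snd z) S). Q z"
    by (subst AE_distr_iff) (simp_all add: override_on_measurable)
  then show ?thesis
    unfolding distr_override_on .
qed

text \<open>By \<open>AE_override_onD\<close> it suffices to treat \<open>override_on u z S\<close>
  with \<open>z\<close> frozen. Membership in \<open>determined\<close> depends only on the
  coordinates in \<open>S\<close>, hence not on \<open>u\<close>, and what is left is the defining
  condition for \<open>z\<close>.\<close>

lemma AE_determined:
  "AE z in P. z \<in> determined S j \<longrightarrow> (AE u in P. \<phi> (override_on u z S) j = \<phi> z j)"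
proof (rule AE_override_onD[where S = S])
  have eq: "override_on u (override_on u' z S) S = override_on u z S" for u u' z :: "int \<Rightarrow> 'a"
    by (auto simp: override_on_def)
  have det: "override_on u z S \<in> determined S j \<longleftrightarrow> z \<in> determined S j"
    if "u \<in> space P" "z \<in> space P" for u z
    using that by (intro determined_cong) auto
  have "AE u in P. override_on u z S \<in> determined S j \<longrightarrow>
      (AE u' in P. \<phi> (override_on u' (override_on u z S) S) j = \<phi> (override_on u z S) j)"
    if z: "z \<in> space P" for z
  proof (cases "z \<in> determined S j")
    case True
    then have "AE u in P. AE v in P. \<phi> (override_on u z S) j = \<phi> (override_on v z S) j"
      by (simp add: determined_def)
    then show ?thesis
      by eventually_elim (simp add: eq eq_commute)
  next
    case False
    then show ?thesis
      using det z by auto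
  qed
  then show "AE z in P. AE u in P. override_on u z S \<in> determined S j \<longrightarrow>
      (AE u' in P. \<phi> (override_on u' (override_on u z S) S) j = \<phi> (override_on u z S) j)"
    by auto
qed measurable

text \<open>\<open>U\<close> and \<open>V\<close> may depend on each other in any way. They share
  the coordinates in \<open>S\<close>, so \<open>V\<close> is determined when \<open>U\<close> is,
  and both outputs equal that of one common resampling.\<close>

lemma AE_coding_eq:
  assumes U: "U \<in> Q \<rightarrow>\<^sub>M P" "distr Q P U = P" and V: "V \<in> Q \<rightarrow>\<^sub>M P" "distr Q P V = P"
    and agree: "\<And>x i. x \<in> space Q \<Longrightarrow> i \<in> S \<Longrightarrow> U x i = V x i"
  shows "AE x in Q. U x \<in> determined S j \<longrightarrow> \<phi> (U x) j = \<phi> (V x) j"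
proof -
  have AE: "AE x in Q. W x \<in> determined S j \<longrightarrow>
      (AE u in P. \<phi> (override_on u (W x) S) j = \<phi> (W x) j)"
    if "W \<in> Q \<rightarrow>\<^sub>M P" "distr Q P W = P" for W
    by (rule AE_distrD[OF that(1)]) (unfold that(2), rule AE_determined)
  show ?thesis
    using AE[OF U] AE[OF V] AE_space
  proof eventually_elim
    case (elim x)
    show ?case
    proof
      assume det: "U x \<in> determined S j"
      have "U x \<in> space P" "V x \<in> space P"
        using U(1) V(1) elim(3) by (auto dest: measurable_space)
      then have "V x \<in> determined S j"
        using det determined_cong agree[OF elim(3)] by blast
      have eq: "override_on u (U x) S = override_on u (V x) S" for u
        using agree[OF elim(3)] by (auto simp: override_on_def)
      \<comment> \<open>A statement free of \<open>u\<close> that holds for almost every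
        \<open>u\<close> is true, since \<open>P\<close> is a probability measure.\<close>
      have "AE u in P. \<phi> (U x) j = \<phi> (V x) j"
        using elim(1)[rule_format, OF det] elim(2)[rule_format, OF \<open>V x \<in> determined S j\<close>]
        by eventually_elim (simp add: eq)
      then show "\<phi> (U x) j = \<phi> (V x) j"
        by simp
    qed
  qed
qed

section \<open>Translation invariance\<close>

definition translate :: "int \<Rightarrow> (int \<Rightarrow> 'c) \<Rightarrow> int \<Rightarrow> 'c" where
  "translate k x = (\<lambda>i. x (i + k))"

lemma translate_measurable [measurable]: "translate k \<in> P \<rightarrow>\<^sub>M P"
  unfolding translate_def by (rule measurable_PiM_single') (auto simp: space_PiM PiE_iff)

lemma translate_in_space [simp]: "x \<in> space P \<Longrightarrow> translate k x \<in> space P"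
  using translate_measurable by (rule measurable_space)

lemma distr_translate: "distr P P (translate k) = P"
  using distr_PiM_reindex[of UNIV "\<lambda>_. N" "\<lambda>i. i + k" UNIV]
  by (simp add: translate_def[abs_def] N.prob_space_axioms restrict_UNIV)

text \<open>Iterating \<open>coding_shift\<close> settles \<open>k \<ge> 0\<close>. For negative
  \<open>k\<close> that case is applied to \<open>translate k x\<close> with \<open>- k\<close>, and
  the translation is then inverted.\<close>

lemma coding_translate: "x \<in> space P \<Longrightarrow> \<phi> (translate k x) = translate k (\<phi> x)"
proof -
  have nat: "\<phi> (translate (int n) x) = translate (int n) (\<phi> x)" if "x \<in> space P" for n x
  proof (induction n)
    case (Suc n)
    have *: "translate (int (Suc n)) y = shift (translate (int n) y)" for y :: "int \<Rightarrow> 'c"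
      by (auto simp: translate_def shift_def algebra_simps)
    show ?case
      unfolding * using coding_shift[of "translate (int n) x"] Suc that by simp
  qed (simp add: translate_def)
  assume x: "x \<in> space P"
  show ?thesis
  proof (cases "k \<ge> 0")
    case True
    then show ?thesis
      using nat[OF x, of "nat k"] by simp
  next
    case False
    have *: "translate (- k) (translate k y) = y" "translate k (translate (- k) y) = y"
      for y :: "int \<Rightarrow> 'c"
      by (auto simp: translate_def)
    have "translate (- k) (\<phi> (translate k x)) = \<phi> x"
      using nat[of "translate k x" "nat (- k)"] x False by (simp add: *)
    then show ?thesis
      by (metis *(2))
  qed
qed

text \<open>A splice with \<open>translate k z\<close> is the translate of a splice with
  \<open>z\<close> along the moved window. The fresh sample becomes
  \<open>translate (- k) u\<close>, which has the same law as \<open>u\<close>, so it can be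
  replaced under both quantifiers.\<close>

lemma translate_in_determined_iff:
  assumes z: "z \<in> space P"
  shows "translate k z \<in> determined S j \<longleftrightarrow> z \<in> determined ((\<lambda>i. i + k) ` S) (j + k)"
proof -
  let ?S = "(\<lambda>i. i + k) ` S"
  have eq: "\<phi> (override_on u (translate k z) S) j = \<phi> (override_on (translate (- k) u) z ?S) (j + k)"
    if u: "u \<in> space P" for u
  proof -
    have "override_on u (translate k z) S = translate k (override_on (translate (- k) u) z ?S)"
      by (auto simp: override_on_def translate_def fun_eq_iff)
    then show ?thesis
      using u z by (simp add: coding_translate) (simp add: translate_def)
  qed
  have AE: "(AE u in P. Q (translate (- k) u)) \<longleftrightarrow> (AE u in P. Q u)"
    if [measurable]: "Measurable.pred P Q" for Q
    using AE_distr_iff[of "translate (- k)" P P Q] unfolding distr_translate by simp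
  have "translate k z \<in> determined S j \<longleftrightarrow> (AE u in P. AE v in P.
      \<phi> (override_on (translate (- k) u) z ?S) (j + k) = \<phi> (override_on (translate (- k) v) z ?S) (j + k))"
    using z by (auto simp: determined_def eq cong: AE_cong_simp)
  also have "\<dots> \<longleftrightarrow> (AE u in P. AE v in P.
      \<phi> (override_on u z ?S) (j + k) = \<phi> (override_on (translate (- k) v) z ?S) (j + k))"
    using z by (intro AE) measurable
  also have "\<dots> \<longleftrightarrow> (AE u in P. AE v in P.
      \<phi> (override_on u z ?S) (j + k) = \<phi> (override_on v z ?S) (j + k))"
    using z by (intro AE_cong AE) measurable
  also have "\<dots> \<longleftrightarrow> z \<in> determined ?S (j + k)"
    using z by (simp add: determined_def)
  finally show ?thesis .
qed

lemma prob_determined_translate: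
  "measure P (determined ((\<lambda>i. i + k) ` S) (j + k)) = measure P (determined S j)"
proof -
  have "measure P (determined S j) = measure (distr P P (translate k)) (determined S j)"
    by (simp add: distr_translate)
  also have "\<dots> = measure P (translate k -` determined S j \<inter> space P)"
    by (rule measure_distr) simp_all
  also have "translate k -` determined S j \<inter> space P = determined ((\<lambda>i. i + k) ` S) (j + k)"
    using translate_in_determined_iff sets.sets_into_space[OF sets_determined] by blast
  finally show ?thesis ..
qed

lemma nn_integral_override_on:
  assumes [measurable]: "G \<in> borel_measurable P"
  shows "(\<integral>\<^sup>+x. G x \<partial>P) = (\<integral>\<^sup>+x. (\<integral>\<^sup>+w. G (override_on w x S) \<partial>P) \<partial>P)"
proof -
  have "(\<integral>\<^sup>+x. G x \<partial>P) = (\<integral>\<^sup>+x. G x \<partial>distr (P \<Otimes>\<^sub>M P) P (\<lambda>z. override_on (fst z) (snd z) S))"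
    unfolding distr_override_on ..
  also have "\<dots> = (\<integral>\<^sup>+z. G (override_on (fst z) (snd z) S) \<partial>(P \<Otimes>\<^sub>M P))"
    by (rule nn_integral_distr) (use override_on_measurable in simp_all)
  also have "\<dots> = (\<integral>\<^sup>+x. (\<integral>\<^sup>+w. G (override_on w x S) \<partial>P) \<partial>P)"
    by (subst PP.nn_integral_snd[symmetric]) simp_all
  finally show ?thesis .
qed

lemma integral_override_on:
  fixes G :: "_ \<Rightarrow> real"
  assumes [measurable]: "G \<in> borel_measurable P" and bound: "\<And>x. x \<in> space P \<Longrightarrow> \<bar>G x\<bar> \<le> C"
  shows "(\<integral>x. G x \<partial>P) = (\<integral>x. (\<integral>w. G (override_on w x S) \<partial>P) \<partial>P)"
proof -
  have "(\<integral>x. G x \<partial>P) = (\<integral>x. G x \<partial>distr (P \<Otimes>\<^sub>M P) P (\<lambda>z. override_on (fst z) (snd z) S))"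
    unfolding distr_override_on ..
  also have "\<dots> = (\<integral>z. G (override_on (fst z) (snd z) S) \<partial>(P \<Otimes>\<^sub>M P))"
    by (rule integral_distr) (use override_on_measurable in simp_all)
  also have "\<dots> = (\<integral>(w, x). G (override_on w x S) \<partial>(P \<Otimes>\<^sub>M P))"
    by (simp add: case_prod_unfold)
  also have "\<dots> = (\<integral>x. (\<integral>w. G (override_on w x S) \<partial>P) \<partial>P)"
  proof (rule PP.integral_snd[symmetric], rule PP.P.integrable_const_bound[where B = C])
    show "AE x in P \<Otimes>\<^sub>M P. norm (case x of (w, x) \<Rightarrow> G (override_on w x S)) \<le> C"
      by (rule AE_I2) (auto simp: space_pair_measure intro!: bound)
  qed measurable
  finally show ?thesis .
qed

text \<open>The window consists of the \<open>k\<close> coordinates from \<open>1 - k\<close> to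
  \<open>0\<close> and is empty for \<open>k = 0\<close>. A radius \<open>r\<close> inspects
  \<open>r + 1\<close> coordinates, so an undetermined point has radius at least
  \<open>k\<close>.\<close>

definition undetermined_prob :: "nat \<Rightarrow> real" where
  "undetermined_prob k = measure P (space P - determined {- int k<..0} 0)"

lemma undetermined_prob_nonneg: "0 \<le> undetermined_prob k"
  by (simp add: undetermined_prob_def)

lemma prob_undetermined:
  assumes "i \<le> j"
  shows "measure P (space P - determined {i<..j} j) = undetermined_prob (nat (j - i))"
proof -
  have *: "(\<lambda>i. i + j) ` {- int (nat (j - i))<..0} = {i<..j}"
    using assms image_add_greaterThanAtMost[of j "i - j" 0] by (simp add: add.commute)
  have "measure P (determined {i<..j} j) = measure P (determined {- int (nat (j - i))<..0} 0)"
    using prob_determined_translate[of j "{- int (nat (j - i))<..0}" 0] unfolding * by simp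
  then show ?thesis
    by (simp add: undetermined_prob_def P.prob_compl)
qed

end

subsection \<open>Exponential moments by martingale differences\<close>

text \<open>\<open>f_diff\<close> merges locality and bounded differences into one inequality;
  \<open>AE_determined_past\<close> is the form in which left finitariness enters.\<close>

locale bounded_difference_coding = iid_coding +
  fixes f :: "(int \<Rightarrow> 'b) \<Rightarrow> real" and J :: "int set" and d :: "int \<Rightarrow> real"
  assumes f_measurable [measurable]: "f \<in> borel_measurable (seq_space B)"
    and finite_J: "finite J"
    and d_nonneg: "\<And>j. 0 \<le> d j"
    and f_diff: "\<And>y y'. y \<in> space (seq_space B) \<Longrightarrow> y' \<in> space (seq_space B) \<Longrightarrow>
      \<bar>f y - f y'\<bar> \<le> (\<Sum>j\<in>J. d j * of_bool (y j \<noteq> y' j))"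
    and AE_determined_past: "\<And>j. AE z in P. z \<in> determined {..j} j"
begin

definition F :: "(int \<Rightarrow> 'a) \<Rightarrow> real" where
  "F x = f (\<phi> x)"

lemma F_measurable [measurable]: "F \<in> borel_measurable P"
  unfolding F_def[abs_def] by measurable

lemma F_diff:
  assumes "x \<in> space P" "x' \<in> space P"
  shows "\<bar>F x - F x'\<bar> \<le> (\<Sum>j\<in>J. d j * of_bool (\<phi> x j \<noteq> \<phi> x' j))"
  unfolding F_def using assms measurable_space[OF coding_measurable] by (intro f_diff) auto

lemma F_bounded: obtains C where "\<And>x. x \<in> space P \<Longrightarrow> \<bar>F x\<bar> \<le> C"
proof -
  obtain x0 where x0: "x0 \<in> space P"
    using P.not_empty by blast
  have "\<bar>F x\<bar> \<le> \<bar>F x0\<bar> + sum d J" if "x \<in> space P" for x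
  proof -
    have "\<bar>F x - F x0\<bar> \<le> (\<Sum>j\<in>J. d j * of_bool (\<phi> x j \<noteq> \<phi> x0 j))"
      using F_diff x0 that by blast
    also have "\<dots> \<le> sum d J"
      by (intro sum_mono) (auto simp: d_nonneg)
    finally show ?thesis by linarith
  qed
  then show thesis by (rule that)
qed

text \<open>An explicit version of the conditional expectation of \<open>F\<close> given the
  coordinates in \<open>S\<close>, defined at every point. The sets \<open>{..i}\<close> yield the
  martingale.\<close>

definition cond_mean :: "int set \<Rightarrow> (int \<Rightarrow> 'a) \<Rightarrow> real" where
  "cond_mean S x = (\<integral>w. F (override_on w x S) \<partial>P)"

lemma cond_mean_measurable [measurable]: "cond_mean S \<in> borel_measurable P"
  unfolding cond_mean_def[abs_def] by measurable

lemma integrable_F_override_on: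
  assumes [simp]: "x \<in> space P"
  shows "integrable P (\<lambda>w. F (override_on w x S))"
proof -
  obtain C where "\<And>x. x \<in> space P \<Longrightarrow> \<bar>F x\<bar> \<le> C"
    by (rule F_bounded) blast
  then show ?thesis
    by (intro P.integrable_const_bound[where B = C]) (auto simp del: space_PiM)
qed

lemma cond_mean_empty: "cond_mean {} x = (\<integral>x. F x \<partial>P)"
  by (simp add: cond_mean_def)

lemma cond_mean_UNIV: "cond_mean UNIV x = F x"
  by (simp add: cond_mean_def override_on_def P.prob_space)

text \<open>Since \<open>S \<subseteq> S'\<close>, the two successive resamplings amount to freezing
  \<open>S\<close> in the splice of \<open>v\<close> and \<open>w\<close> along \<open>S'\<close>,
  and that splice has law \<open>P\<close>.\<close>

lemma cond_mean_tower:
  assumes x: "x \<in> space P" and "S \<subseteq> S'"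
  shows "(\<integral>w. cond_mean S' (override_on w x S) \<partial>P) = cond_mean S x"
proof -
  obtain C where C: "\<And>x. x \<in> space P \<Longrightarrow> \<bar>F x\<bar> \<le> C"
    by (rule F_bounded) blast
  have eq: "override_on v (override_on w x S) S' = override_on (override_on v w S') x S"
    for v w :: "int \<Rightarrow> 'a"
    using \<open>S \<subseteq> S'\<close> by (auto simp: override_on_def fun_eq_iff)
  have "(\<integral>w. F (override_on w x S) \<partial>P) = (\<integral>w. (\<integral>v. F (override_on (override_on v w S') x S) \<partial>P) \<partial>P)"
    by (rule integral_override_on[where C = C]) (use x in \<open>auto intro!: C\<close>)
  then show ?thesis
    by (simp add: cond_mean_def eq)
qed

lemma cond_mean_cong:
  assumes "\<And>i. i \<in> S \<Longrightarrow> x i = x' i"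
  shows "cond_mean S x = cond_mean S x'"
proof -
  have "override_on w x S = override_on w x' S" for w
    using assms by (auto simp: override_on_def)
  then show ?thesis
    by (simp add: cond_mean_def)
qed

lemma AE_F_diff:
  assumes U: "U \<in> Q \<rightarrow>\<^sub>M P" "distr Q P U = P" and V: "V \<in> Q \<rightarrow>\<^sub>M P" "distr Q P V = P"
    and agree: "\<And>x i j. x \<in> space Q \<Longrightarrow> j \<in> J \<Longrightarrow> i \<in> S j \<Longrightarrow> U x i = V x i"
  shows "AE x in Q. \<bar>F (U x) - F (V x)\<bar> \<le> (\<Sum>j\<in>J. d j * of_bool (U x \<notin> determined (S j) j))"
proof -
  have "AE x in Q. \<forall>j\<in>J. U x \<in> determined (S j) j \<longrightarrow> \<phi> (U x) j = \<phi> (V x) j"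
    using finite_J agree by (intro AE_finite_allI AE_coding_eq U V) auto
  then show ?thesis
    using AE_space
  proof eventually_elim
    case (elim x)
    have "\<bar>F (U x) - F (V x)\<bar> \<le> (\<Sum>j\<in>J. d j * of_bool (\<phi> (U x) j \<noteq> \<phi> (V x) j))"
      using elim(2) U(1) V(1) by (intro F_diff) (auto dest: measurable_space)
    also have "\<dots> \<le> (\<Sum>j\<in>J. d j * of_bool (U x \<notin> determined (S j) j))"
      using elim(1) by (intro sum_mono mult_left_mono d_nonneg) (auto simp: of_bool_def)
    finally show ?case .
  qed
qed

text \<open>Both means use the same fresh sample. For \<open>j\<close> in \<open>K\<close> the two
  splices agree on \<open>{i<..j}\<close>, where both read that sample; for other \<open>j\<close>
  they agree on \<open>{..j}\<close>, which almost surely determines the output and so costs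
  nothing. The cases needed are \<open>T\<close> equal to \<open>{..i - 1}\<close>,
  \<open>UNIV\<close> and \<open>{}\<close>.\<close>

lemma cond_mean_diff:
  assumes K: "K \<subseteq> J" "\<And>j. j \<in> K \<Longrightarrow> i \<le> j" "\<And>j. j \<in> K \<Longrightarrow> {i<..j} \<inter> T = {}"
    and past: "\<And>j. j \<in> J - K \<Longrightarrow> {..j} \<inter> T = {..j} \<inter> {..i}"
  shows "AE x in P. \<bar>cond_mean {..i} x - cond_mean T x\<bar>
      \<le> (\<Sum>j\<in>K. d j * undetermined_prob (nat (j - i)))"
proof -
  define S where "S = (\<lambda>j. if j \<in> K then {i<..j} else {..j})"
  define U where "U = (\<lambda>z::(int \<Rightarrow> 'a) \<times> (int \<Rightarrow> 'a). override_on (fst z) (snd z) {..i})"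
  define V where "V = (\<lambda>z::(int \<Rightarrow> 'a) \<times> (int \<Rightarrow> 'a). override_on (fst z) (snd z) T)"
  have U: "U \<in> P \<Otimes>\<^sub>M P \<rightarrow>\<^sub>M P" "distr (P \<Otimes>\<^sub>M P) P U = P"
    and V: "V \<in> P \<Otimes>\<^sub>M P \<rightarrow>\<^sub>M P" "distr (P \<Otimes>\<^sub>M P) P V = P"
    by (simp_all add: U_def V_def override_on_measurable distr_override_on)
  have "U z l = V z l" if "j \<in> J" "l \<in> S j" for z l j
  proof (cases "j \<in> K")
    case True
    then have "l \<in> {i<..j}"
      using that(2) by (simp add: S_def)
    then have "l \<notin> T" "l \<notin> {..i}"
      using K(3)[OF True] by auto
    then show ?thesis
      by (simp add: U_def V_def)
  next
    case False
    then have "l \<in> {..j}"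
      using that(2) by (simp add: S_def)
    moreover have "l \<in> {..j} \<inter> T \<longleftrightarrow> l \<in> {..j} \<inter> {..i}"
      using past[of j] that(1) False by simp
    ultimately have "l \<in> T \<longleftrightarrow> l \<in> {..i}"
      by blast
    then show ?thesis
      unfolding U_def V_def override_on_def by simp
  qed
  then have agree: "\<And>z l j. z \<in> space (P \<Otimes>\<^sub>M P) \<Longrightarrow> j \<in> J \<Longrightarrow> l \<in> S j \<Longrightarrow> U z l = V z l"
    by blast
  have 1: "AE z in P \<Otimes>\<^sub>M P. \<bar>F (U z) - F (V z)\<bar>
      \<le> (\<Sum>j\<in>J. d j * of_bool (U z \<notin> determined (S j) j))"
    by (rule AE_F_diff[OF U V agree])
  have "AE z in P \<Otimes>\<^sub>M P. U z \<in> determined {..j} j" for j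
    by (rule AE_distrD[OF U(1)]) (unfold U(2), rule AE_determined_past)
  then have 2: "AE z in P \<Otimes>\<^sub>M P. \<forall>j\<in>J. U z \<in> determined {..j} j"
    by (intro AE_finite_allI finite_J)
  have "AE z in P \<Otimes>\<^sub>M P. \<bar>F (U z) - F (V z)\<bar>
      \<le> (\<Sum>j\<in>K. d j * of_bool (fst z \<notin> determined {i<..j} j))"
    using 1 2 AE_space
  proof eventually_elim
    case (elim z)
    have z: "fst z \<in> space P" "snd z \<in> space P"
      using elim(3) by (auto simp: space_pair_measure)
    have *: "U z \<in> determined {i<..j} j \<longleftrightarrow> fst z \<in> determined {i<..j} j" for j
      using z unfolding U_def by (intro determined_cong) auto
    have "(\<Sum>j\<in>J. d j * of_bool (U z \<notin> determined (S j) j))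
        = (\<Sum>j\<in>K. d j * of_bool (fst z \<notin> determined {i<..j} j))"
      using K(1) finite_J elim(2) by (intro sum.mono_neutral_cong_right) (auto simp: S_def *)
    with elim(1) show ?case by simp
  qed
  then have "AE z in P \<Otimes>\<^sub>M P. \<bar>F (override_on (fst z) (snd z) {..i}) - F (override_on (fst z) (snd z) T)\<bar>
      \<le> (\<Sum>j\<in>K. d j * of_bool (fst z \<notin> determined {i<..j} j))"
    by (simp only: U_def V_def)
  then have "AE w in P. AE x in P. \<bar>F (override_on w x {..i}) - F (override_on w x T)\<bar>
      \<le> (\<Sum>j\<in>K. d j * of_bool (w \<notin> determined {i<..j} j))"
    by (drule_tac PP.AE_pair) simp
  then have "AE x in P. AE w in P. \<bar>F (override_on w x {..i}) - F (override_on w x T)\<bar>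
      \<le> (\<Sum>j\<in>K. d j * of_bool (w \<notin> determined {i<..j} j))"
    by (subst PP.AE_commute) measurable
  then show ?thesis
    using AE_space
  proof eventually_elim
    case (elim x)
    let ?I = "\<lambda>w. \<Sum>j\<in>K. d j * indicator (space P - determined {i<..j} j) w :: real"
    have int: "integrable P (\<lambda>w. d j * indicator (space P - determined {i<..j} j) w :: real)" for j
      by (intro integrable_mult_right P.integrable_const_bound[where B = 1]) simp_all
    have "\<bar>cond_mean {..i} x - cond_mean T x\<bar>
        = \<bar>\<integral>w. F (override_on w x {..i}) - F (override_on w x T) \<partial>P\<bar>"
      unfolding cond_mean_def
      by (subst Bochner_Integration.integral_diff) (simp_all add: integrable_F_override_on elim(2))
    also have "\<dots> \<le> (\<integral>w. \<bar>F (override_on w x {..i}) - F (override_on w x T)\<bar> \<partial>P)"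
      by (rule integral_abs_bound)
    also have "\<dots> \<le> (\<integral>w. ?I w \<partial>P)"
    proof (rule integral_mono_AE)
      show "AE w in P. \<bar>F (override_on w x {..i}) - F (override_on w x T)\<bar> \<le> ?I w"
        using elim(1) AE_space
        by eventually_elim (auto simp: indicator_def of_bool_def)
    qed (auto intro!: integrable_abs Bochner_Integration.integrable_diff
          integrable_F_override_on elim(2) int Bochner_Integration.integrable_sum simp del: integrable_mult_right_iff)
    also have "\<dots> = (\<Sum>j\<in>K. d j * measure P (space P - determined {i<..j} j))"
      by (subst Bochner_Integration.integral_sum[OF int]) (simp add: Int_absorb2)
    also have "\<dots> = (\<Sum>j\<in>K. d j * undetermined_prob (nat (j - i)))"
      using K(2) by (intro sum.cong) (auto simp: prob_undetermined)
    finally show ?case .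
  qed
qed

text \<open>
  Resampling the coordinates outside \<open>S\<close> turns this into Hoeffding's lemma for the increment,
  conditionally on the coordinates in \<open>S\<close>.
\<close>

lemma nn_integral_exp_cond_mean_le:
  assumes t: "0 < t" and "S \<subseteq> S'"
    and diff: "AE x in P. \<bar>cond_mean S' x - cond_mean S x\<bar> \<le> c"
  shows "(\<integral>\<^sup>+x. exp (t * cond_mean S' x) \<partial>P)
      \<le> ennreal (exp (t\<^sup>2 * c\<^sup>2 / 2)) * (\<integral>\<^sup>+x. exp (t * cond_mean S x) \<partial>P)"
proof -
  have "(\<integral>\<^sup>+x. exp (t * cond_mean S' x) \<partial>P)
      = (\<integral>\<^sup>+x. (\<integral>\<^sup>+w. exp (t * cond_mean S' (override_on w x S)) \<partial>P) \<partial>P)"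
    by (rule nn_integral_override_on) measurable
  also have "\<dots> \<le> (\<integral>\<^sup>+x. ennreal (exp (t\<^sup>2 * c\<^sup>2 / 2)) * exp (t * cond_mean S x) \<partial>P)"
  proof (rule nn_integral_mono_AE)
    have "AE x in P. AE w in P.
        \<bar>cond_mean S' (override_on w x S) - cond_mean S (override_on w x S)\<bar> \<le> c"
      by (rule AE_override_on[OF _ diff]) measurable
    then show "AE x in P. (\<integral>\<^sup>+w. exp (t * cond_mean S' (override_on w x S)) \<partial>P)
        \<le> ennreal (exp (t\<^sup>2 * c\<^sup>2 / 2)) * exp (t * cond_mean S x)"
      using AE_space
    proof eventually_elim
      case (elim x)
      note [simp] = elim(2)
      have S: "cond_mean S (override_on w x S) = cond_mean S x" for w
        by (rule cond_mean_cong) simp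
      define h where "h = (\<lambda>w. cond_mean S' (override_on w x S) - cond_mean S x)"
      have [measurable]: "h \<in> borel_measurable P"
        unfolding h_def by measurable
      have h: "AE w in P. h w \<in> {- c..c}"
        using elim(1) unfolding S h_def by eventually_elim auto
      interpret interval_bounded_random_variable P h "- c" c
        by unfold_locales (use h in auto)
      have "integrable P (\<lambda>w. h w + cond_mean S x)"
        by (intro Bochner_Integration.integrable_add integrable) simp
      then have "integrable P (\<lambda>w. cond_mean S' (override_on w x S))"
        by (simp add: h_def)
      then have "(\<integral>w. h w \<partial>P) = 0"
        by (simp add: h_def cond_mean_tower \<open>S \<subseteq> S'\<close> P.prob_space)
      then have "(\<integral>\<^sup>+w. exp (t * h w) \<partial>P) \<le> exp (t\<^sup>2 * (c - (- c))\<^sup>2 / 8)"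
        by (intro Hoeffdings_lemma_nn_integral_0 t)
      \<comment> \<open>The increment ranges over an interval of length \<open>2 * c\<close>, which
        is where the factor \<open>1/2\<close> arises.\<close>
      also have "t\<^sup>2 * (c - (- c))\<^sup>2 / 8 = t\<^sup>2 * c\<^sup>2 / 2"
        by (simp add: power2_eq_square)
      finally have Hoeffding: "(\<integral>\<^sup>+w. exp (t * h w) \<partial>P) \<le> exp (t\<^sup>2 * c\<^sup>2 / 2)" .
      have "(\<integral>\<^sup>+w. exp (t * cond_mean S' (override_on w x S)) \<partial>P)
          = (\<integral>\<^sup>+w. ennreal (exp (t * h w)) * exp (t * cond_mean S x) \<partial>P)"
        by (intro nn_integral_cong)
          (simp add: h_def ennreal_mult'[symmetric] exp_add[symmetric] algebra_simps)
      also have "\<dots> = (\<integral>\<^sup>+w. exp (t * h w) \<partial>P) * exp (t * cond_mean S x)"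
        by (rule nn_integral_multc) measurable
      also have "\<dots> \<le> ennreal (exp (t\<^sup>2 * c\<^sup>2 / 2)) * exp (t * cond_mean S x)"
        using Hoeffding by (rule mult_right_mono) simp
      finally show ?case .
    qed
  qed
  also have "\<dots> = ennreal (exp (t\<^sup>2 * c\<^sup>2 / 2)) * (\<integral>\<^sup>+x. exp (t * cond_mean S x) \<partial>P)"
    by (rule nn_integral_cmult) measurable
  finally show ?thesis .
qed

section \<open>Telescoping the martingale differences\<close>

definition increment_bound :: "int \<Rightarrow> real" where
  "increment_bound i = (\<Sum>j\<in>{j\<in>J. i \<le> j}. d j * undetermined_prob (nat (j - i)))"

lemma cond_mean_increment:
  "AE x in P. \<bar>cond_mean {..i} x - cond_mean {..i - 1} x\<bar> \<le> increment_bound i"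
  unfolding increment_bound_def by (rule cond_mean_diff) auto

text \<open>Each newly revealed coordinate costs one Hoeffding factor. The induction starts at a
  finite \<open>l\<close> because the index set has no first element.\<close>

lemma nn_integral_exp_cond_mean_telescope:
  assumes t: "0 < t"
  shows "(\<integral>\<^sup>+x. exp (t * cond_mean {..l + int n} x) \<partial>P)
      \<le> ennreal (exp (t\<^sup>2 * (\<Sum>i\<in>{l<..l + int n}. (increment_bound i)\<^sup>2) / 2))
        * (\<integral>\<^sup>+x. exp (t * cond_mean {..l} x) \<partial>P)"
proof (induction n)
  case (Suc n)
  let ?i = "l + int (Suc n)"
  have i: "?i - 1 = l + int n"
    by simp
  have "(\<integral>\<^sup>+x. exp (t * cond_mean {..?i} x) \<partial>P)
      \<le> ennreal (exp (t\<^sup>2 * (increment_bound ?i)\<^sup>2 / 2))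
        * (\<integral>\<^sup>+x. exp (t * cond_mean {..?i - 1} x) \<partial>P)"
    by (rule nn_integral_exp_cond_mean_le[OF t _ cond_mean_increment]) auto
  also have "\<dots> \<le> ennreal (exp (t\<^sup>2 * (increment_bound ?i)\<^sup>2 / 2))
      * (ennreal (exp (t\<^sup>2 * (\<Sum>i\<in>{l<..l + int n}. (increment_bound i)\<^sup>2) / 2))
        * (\<integral>\<^sup>+x. exp (t * cond_mean {..l} x) \<partial>P))"
    unfolding i by (intro mult_left_mono Suc.IH) simp
  also have "\<dots> = ennreal (exp (t\<^sup>2 * (increment_bound ?i)\<^sup>2 / 2)
      * exp (t\<^sup>2 * (\<Sum>i\<in>{l<..l + int n}. (increment_bound i)\<^sup>2) / 2))
        * (\<integral>\<^sup>+x. exp (t * cond_mean {..l} x) \<partial>P)"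
    by (simp add: ennreal_mult mult.assoc)
  also have "exp (t\<^sup>2 * (increment_bound ?i)\<^sup>2 / 2)
      * exp (t\<^sup>2 * (\<Sum>i\<in>{l<..l + int n}. (increment_bound i)\<^sup>2) / 2)
      = exp (t\<^sup>2 * (\<Sum>i\<in>{l<..?i}. (increment_bound i)\<^sup>2) / 2)"
  proof -
    have "{l<..?i} = insert ?i {l<..l + int n}"
      by auto
    then have "(\<Sum>i\<in>{l<..?i}. (increment_bound i)\<^sup>2)
        = (increment_bound ?i)\<^sup>2 + (\<Sum>i\<in>{l<..l + int n}. (increment_bound i)\<^sup>2)"
      by simp
    then show ?thesis
      by (simp only: exp_add[symmetric] add_divide_distrib distrib_left)
  qed
  finally show ?case .
qed simp

text \<open>At the right end, \<open>{..m}\<close> already determines \<open>F\<close> almost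
  surely. At the left end, knowing the coordinates up to \<open>l\<close> moves the mean by at most
  the sum over \<open>J\<close> in the exponent.\<close>

lemma nn_integral_exp_le:
  assumes t: "0 < t" and m: "J \<subseteq> {..m}" and l: "\<And>j. j \<in> J \<Longrightarrow> l \<le> j" and "l \<le> m"
  shows "(\<integral>\<^sup>+x. exp (t * F x) \<partial>P) \<le> exp (t\<^sup>2 * (\<Sum>i\<in>{l<..m}. (increment_bound i)\<^sup>2) / 2
      + t * ((\<integral>x. F x \<partial>P) + (\<Sum>j\<in>J. d j * undetermined_prob (nat (j - l)))))"
proof -
  let ?V = "\<Sum>i\<in>{l<..m}. (increment_bound i)\<^sup>2"
  let ?e = "\<Sum>j\<in>J. d j * undetermined_prob (nat (j - l))"
  \<comment> \<open>With \<open>K = {}\<close> the bound is an empty sum, so the two means agree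
    almost surely.\<close>
  have "AE x in P. \<bar>cond_mean {..m} x - cond_mean UNIV x\<bar>
      \<le> (\<Sum>j\<in>{}. d j * undetermined_prob (nat (j - m)))"
    using m by (intro cond_mean_diff) auto
  then have "AE x in P. F x = cond_mean {..m} x"
    by eventually_elim (simp add: cond_mean_UNIV)
  then have "(\<integral>\<^sup>+x. exp (t * F x) \<partial>P) = (\<integral>\<^sup>+x. exp (t * cond_mean {..m} x) \<partial>P)"
    by (intro nn_integral_cong_AE) (elim eventually_mono, simp)
  also have "\<dots> \<le> ennreal (exp (t\<^sup>2 * ?V / 2)) * (\<integral>\<^sup>+x. exp (t * cond_mean {..l} x) \<partial>P)"
    using nn_integral_exp_cond_mean_telescope[OF t, of l "nat (m - l)"] \<open>l \<le> m\<close> by simp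
  also have "(\<integral>\<^sup>+x. exp (t * cond_mean {..l} x) \<partial>P) \<le> (\<integral>\<^sup>+x. exp (t * ((\<integral>x. F x \<partial>P) + ?e)) \<partial>P)"
  proof (rule nn_integral_mono_AE)
    have "AE x in P. \<bar>cond_mean {..l} x - cond_mean {} x\<bar> \<le> ?e"
      using l by (intro cond_mean_diff) auto
    then show "AE x in P. ennreal (exp (t * cond_mean {..l} x)) \<le> exp (t * ((\<integral>x. F x \<partial>P) + ?e))"
      by eventually_elim (use t in \<open>auto simp: cond_mean_empty intro!: ennreal_leI\<close>)
  qed
  also have "\<dots> = exp (t * ((\<integral>x. F x \<partial>P) + ?e))"
    by (simp add: P.emeasure_space_1)
  finally show ?thesis
    by (simp add: exp_add ennreal_mult mult_left_mono)
qed

text \<open>The left end is sent to minus infinity: the error there vanishes because the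
  undetermined probabilities tend to zero, while \<open>V\<close> bounds the sum of squares for
  every truncation.\<close>

lemma integral_exp_le:
  assumes t: "0 < t" and tail: "undetermined_prob \<longlonglongrightarrow> 0"
    and V: "\<And>I. finite I \<Longrightarrow> (\<Sum>i\<in>I. (increment_bound i)\<^sup>2) \<le> V"
  shows "(\<integral>x. exp (t * (F x - (\<integral>x. F x \<partial>P))) \<partial>P) \<le> exp (t\<^sup>2 * V / 2)"
proof -
  define \<mu> where "\<mu> = (\<integral>x. F x \<partial>P)"
  obtain a m where am: "J \<subseteq> {a..m}" "a \<le> m"
  proof -
    \<comment> \<open>Inserting \<open>0\<close> keeps \<open>Min\<close> and \<open>Max\<close>
      meaningful when \<open>J\<close> is empty and gives \<open>a \<le> m\<close>.\<close>
    have "J \<subseteq> {Min (insert 0 J)..Max (insert 0 J)}"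
      using finite_J by auto
    moreover have "Min (insert 0 J) \<le> 0" "0 \<le> Max (insert 0 J)"
      using finite_J by (auto simp del: Min_insert Max_insert intro: Min_le Max_ge)
    ultimately show thesis
      using that order_trans by blast
  qed
  define e where "e = (\<lambda>n. \<Sum>j\<in>J. d j * undetermined_prob (nat (j - (a - int n))))"
  have "e \<longlonglongrightarrow> (\<Sum>j\<in>J. d j * 0)"
    unfolding e_def
  proof (intro tendsto_sum tendsto_mult tendsto_const)
    fix j assume "j \<in> J"
    have "filterlim (\<lambda>n. nat (j - (a - int n))) sequentially sequentially"
      unfolding filterlim_at_top eventually_sequentially
    proof (intro allI exI impI)
      fix Z n :: nat assume "Z \<le> n"
      moreover have "a \<le> j"
        using \<open>j \<in> J\<close> am(1) by auto
      ultimately show "Z \<le> nat (j - (a - int n))"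
        by linarith
    qed
    then show "(\<lambda>n. undetermined_prob (nat (j - (a - int n)))) \<longlonglongrightarrow> 0"
      by (rule filterlim_compose[OF tail])
  qed
  then have e: "e \<longlonglongrightarrow> 0"
    by simp
  have "(\<integral>\<^sup>+x. exp (t * F x) \<partial>P) \<le> exp (t\<^sup>2 * V / 2 + t * (\<mu> + e n))" for n
  proof -
    let ?l = "a - int n"
    have "(\<integral>\<^sup>+x. exp (t * F x) \<partial>P)
        \<le> exp (t\<^sup>2 * (\<Sum>i\<in>{?l<..m}. (increment_bound i)\<^sup>2) / 2 + t * (\<mu> + e n))"
      unfolding \<mu>_def e_def using am by (intro nn_integral_exp_le t) auto
    also have "\<dots> \<le> exp (t\<^sup>2 * V / 2 + t * (\<mu> + e n))"
      by (intro ennreal_leI) (simp add: V mult_left_mono)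
    finally show ?thesis .
  qed
  moreover have "(\<lambda>n. ennreal (exp (t\<^sup>2 * V / 2 + t * (\<mu> + e n))))
      \<longlonglongrightarrow> ennreal (exp (t\<^sup>2 * V / 2 + t * (\<mu> + 0)))"
    by (intro tendsto_intros tendsto_ennrealI e)
  ultimately have "(\<integral>\<^sup>+x. exp (t * F x) \<partial>P) \<le> exp (t\<^sup>2 * V / 2 + t * (\<mu> + 0))"
    using LIMSEQ_le_const by blast
  then have le: "(\<integral>\<^sup>+x. exp (t * F x) \<partial>P) \<le> exp (t\<^sup>2 * V / 2 + t * \<mu>)"
    by simp
  have "exp (t * (F x - \<mu>)) = exp (t * F x) * exp (- t * \<mu>)" for x
    unfolding exp_add[symmetric] by (simp add: right_diff_distrib)
  then have "(\<integral>\<^sup>+x. exp (t * (F x - \<mu>)) \<partial>P)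
      = (\<integral>\<^sup>+x. ennreal (exp (t * F x)) * exp (- t * \<mu>) \<partial>P)"
    by (simp add: ennreal_mult)
  also have "\<dots> = (\<integral>\<^sup>+x. exp (t * F x) \<partial>P) * exp (- t * \<mu>)"
    by (rule nn_integral_multc) measurable
  also have "\<dots> \<le> ennreal (exp (t\<^sup>2 * V / 2 + t * \<mu>)) * exp (- t * \<mu>)"
    by (intro mult_right_mono le) simp
  also have "\<dots> = exp (t\<^sup>2 * V / 2)"
    by (simp add: ennreal_mult'[symmetric] exp_add[symmetric])
  finally have "(\<integral>\<^sup>+x. exp (t * (F x - \<mu>)) \<partial>P) \<le> exp (t\<^sup>2 * V / 2)" .
  then show ?thesis
    unfolding \<mu>_def[symmetric] by (intro integral_real_bounded) auto
qed

text \<open>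
  Young's inequality \<open>\<parallel>d \<star> q\<parallel>\<^sub>2 \<le> \<parallel>q\<parallel>\<^sub>1 \<parallel>d\<parallel>\<^sub>2\<close> with \<open>q\<close> = \<open>undetermined_prob\<close>.
\<close>

lemma sum_increment_bound_sq_le:
  assumes Q: "\<And>n. (\<Sum>k<n. undetermined_prob k) \<le> Q" and I: "finite I"
  shows "(\<Sum>i\<in>I. (increment_bound i)\<^sup>2) \<le> Q\<^sup>2 * (\<Sum>j\<in>J. (d j)\<^sup>2)"
proof -
  let ?q = undetermined_prob
  have Q0: "0 \<le> Q"
    using Q[of 0] by simp
  \<comment> \<open>An injective \<open>g\<close> picks distinct terms of the series, so their sum
    is at most a partial sum.\<close>
  have Q_image: "(\<Sum>x\<in>K. ?q (g x)) \<le> Q" if "finite K" "inj_on g K" for K :: "int set" and g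
  proof -
    obtain n where n: "g ` K \<subseteq> {..<n}"
      using finite_nat_set_iff_bounded[of "g ` K"] \<open>finite K\<close> by auto
    have "(\<Sum>x\<in>K. ?q (g x)) = (\<Sum>k\<in>g ` K. ?q k)"
      using that by (simp add: sum.reindex)
    also have "\<dots> \<le> (\<Sum>k<n. ?q k)"
      using n by (intro sum_mono2) (auto simp: undetermined_prob_nonneg)
    finally show ?thesis
      using Q order_trans by blast
  qed
  have "(\<Sum>i\<in>I. (increment_bound i)\<^sup>2)
      \<le> (\<Sum>i\<in>I. Q * (\<Sum>j\<in>{j\<in>J. i \<le> j}. (d j)\<^sup>2 * ?q (nat (j - i))))"
  proof (rule sum_mono)
    fix i
    let ?K = "{j\<in>J. i \<le> j}"
    \<comment> \<open>Each term \<open>d * q\<close> is split as \<open>sqrt q\<close> times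
      \<open>d * sqrt q\<close> for Cauchy-Schwarz; the squares of the first factors sum to at most
      \<open>Q\<close>.\<close>
    have "(increment_bound i)\<^sup>2
        = (\<Sum>j\<in>?K. sqrt (?q (nat (j - i))) * (d j * sqrt (?q (nat (j - i)))))\<^sup>2"
      unfolding increment_bound_def
      by (intro arg_cong[where f = "\<lambda>x. x\<^sup>2"] sum.cong)
        (simp_all add: undetermined_prob_nonneg mult.left_commute)
    also have "\<dots> \<le> (\<Sum>j\<in>?K. ?q (nat (j - i))) * (\<Sum>j\<in>?K. (d j)\<^sup>2 * ?q (nat (j - i)))"
      using Cauchy_Schwarz_ineq_sum[of "\<lambda>j. sqrt (?q (nat (j - i)))"
          "\<lambda>j. d j * sqrt (?q (nat (j - i)))" ?K]
      by (simp add: power_mult_distrib undetermined_prob_nonneg)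
    also have "\<dots> \<le> Q * (\<Sum>j\<in>?K. (d j)\<^sup>2 * ?q (nat (j - i)))"
      using finite_J
      by (intro mult_right_mono Q_image sum_nonneg) (auto simp: inj_on_def undetermined_prob_nonneg)
    finally show "(increment_bound i)\<^sup>2 \<le> Q * (\<Sum>j\<in>?K. (d j)\<^sup>2 * ?q (nat (j - i)))" .
  qed
  \<comment> \<open>After the exchange of sums \<open>j\<close> is fixed and \<open>i\<close>
    varies; \<open>j - i\<close> is again injective, which yields the second factor
    \<open>Q\<close>.\<close>
  also have "\<dots> = Q * (\<Sum>j\<in>J. \<Sum>i\<in>{i\<in>I. i \<le> j}. (d j)\<^sup>2 * ?q (nat (j - i)))"
    using sum.swap_restrict[OF I finite_J] by (simp add: sum_distrib_left)
  also have "\<dots> = Q * (\<Sum>j\<in>J. (d j)\<^sup>2 * (\<Sum>i\<in>{i\<in>I. i \<le> j}. ?q (nat (j - i))))"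
    by (simp add: sum_distrib_left)
  also have "\<dots> \<le> Q * (\<Sum>j\<in>J. (d j)\<^sup>2 * Q)"
    using I by (intro mult_left_mono sum_mono Q_image Q0) (auto simp: inj_on_def)
  also have "\<dots> = Q\<^sup>2 * (\<Sum>j\<in>J. (d j)\<^sup>2)"
    by (simp add: sum_distrib_right[symmetric] power2_eq_square)
  finally show ?thesis .
qed

text \<open>The bounded partial sums serve twice: they force the probabilities to tend to zero, and
  they enter Young's inequality.\<close>

lemma integral_exp_le_window:
  assumes t: "0 < t" and Q: "\<And>n. (\<Sum>k<n. undetermined_prob k) \<le> Q"
  shows "(\<integral>x. exp (t * (F x - (\<integral>x. F x \<partial>P))) \<partial>P) \<le> exp (t\<^sup>2 * (Q\<^sup>2 * (\<Sum>j\<in>J. (d j)\<^sup>2)) / 2)"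
proof -
  have "summable undetermined_prob"
    by (rule summableI_nonneg_bounded[OF undetermined_prob_nonneg Q])
  then have "undetermined_prob \<longlonglongrightarrow> 0"
    by (rule summable_LIMSEQ_zero)
  then show ?thesis
    by (rule integral_exp_le[OF t _ sum_increment_bound_sq_le[OF Q]])
qed

end

section \<open>From the coding radius to determined coordinates\<close>

context iid_coding
begin

text \<open>With a radius \<open>r < k\<close> the coordinates in \<open>{- int r..0}\<close>, all
  of them in \<open>S\<close>, fix the output for every competitor, without exceptional null set.
  Allowing larger \<open>S\<close> covers the full past \<open>{..0}\<close>.\<close>

lemma in_determined_if_left_radius_less:
  assumes z: "z \<in> space P" and r: "left_radius N \<phi> z < enat k" and S: "{- int k<..0} \<subseteq> S"
  shows "z \<in> determined S 0"
proof -
  obtain r where r: "r < k"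
    and eq: "\<And>y. y \<in> space P \<Longrightarrow> (\<And>i. i \<in> {- int r..0} \<Longrightarrow> y i = z i) \<Longrightarrow> \<phi> y 0 = \<phi> z 0"
    using r unfolding left_radius_def Inf_less_iff by auto
  have "\<phi> (override_on u z S) 0 = \<phi> z 0" if "u \<in> space P" for u
  proof (rule eq)
    fix i assume "i \<in> {- int r..0}"
    then have "i \<in> S"
      using r S by auto
    then show "override_on u z S i = z i"
      by simp
  qed (use that z in simp)
  then show ?thesis
    using z by (simp add: determined_def)
qed

text \<open>With finite radius \<open>r\<close> only the indices \<open>k \<le> r\<close> can
  contribute, so the sum is at most \<open>r + 1\<close>, hence at most \<open>2 * r + 1\<close>.
  With infinite radius the right side is infinite.\<close>

lemma sum_indicator_undetermined_le:
  assumes z: "z \<in> space P"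
  shows "(\<Sum>k<n. indicator (space P - determined {- int k<..0} 0) z :: ennreal)
      \<le> 2 * ennreal_of_enat (left_radius N \<phi> z) + 1"
proof (cases "left_radius N \<phi> z")
  case (enat r)
  have "(\<Sum>k<n. indicator (space P - determined {- int k<..0} 0) z :: ennreal)
      \<le> (\<Sum>k<n. of_bool (k \<le> r))"
  proof (rule sum_mono)
    fix k
    show "(indicator (space P - determined {- int k<..0} 0) z :: ennreal) \<le> of_bool (k \<le> r)"
      using in_determined_if_left_radius_less[OF z, of k "{- int k<..0}"] enat
      by (cases "k \<le> r") (auto simp: indicator_def)
  qed
  also have "\<dots> = of_nat (card ({..<n} \<inter> {k. k \<le> r}))"
    by (simp add: sum_of_bool_eq)
  also have "\<dots> \<le> of_nat (card {..r})"
    by (intro of_nat_mono card_mono) auto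
  also have "\<dots> = of_nat r + 1"
    by simp
  also have "\<dots> \<le> 2 * ennreal_of_enat (left_radius N \<phi> z) + 1"
    using enat by (simp add: mult_2 add_increasing)
  finally show ?thesis .
qed (simp add: ennreal_mult_top)

end

subsection \<open>Oscillations and the coding radius\<close>

lemma diff_le_osc:
  assumes "bounded_differences B f" "y \<in> space (seq_space B)" "y' \<in> space (seq_space B)"
    and "\<And>l. l \<noteq> j \<Longrightarrow> y l = y' l"
  shows "\<bar>f y - f y'\<bar> \<le> enn2real (osc B f j)"
proof -
  have "ennreal \<bar>f y - f y'\<bar> \<le> osc B f j"
    unfolding osc_def by (rule Sup_upper) (use assms in blast)
  \<comment> \<open>\<open>enn2real\<close> sends infinity to zero, so this passage to reals relies
    on the oscillation being finite.\<close>
  then have "enn2real (ennreal \<bar>f y - f y'\<bar>) \<le> enn2real (osc B f j)"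
    by (rule enn2real_mono) (use assms(1) in \<open>simp add: bounded_differences_def\<close>)
  then show ?thesis
    by simp
qed

text \<open>Coordinates are switched from \<open>y\<close> to \<open>y'\<close> one at a time; a
  switch between equal values is free, which explains \<open>of_bool\<close>.\<close>

lemma diff_override_on_le_sum_osc:
  assumes bd: "bounded_differences B f"
    and y: "y \<in> space (seq_space B)" and y': "y' \<in> space (seq_space B)" and "finite K"
  shows "\<bar>f y - f (override_on y y' K)\<bar> \<le> (\<Sum>j\<in>K. enn2real (osc B f j) * of_bool (y j \<noteq> y' j))"
  using \<open>finite K\<close>
proof induction
  case (insert k K)
  have "\<bar>f (override_on y y' K) - f (override_on y y' (insert k K))\<bar>
      \<le> enn2real (osc B f k) * of_bool (y k \<noteq> y' k)"
  proof (cases "y k = y' k")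
    case True
    then have "override_on y y' (insert k K) = override_on y y' K"
      by (auto simp: override_on_def)
    then show ?thesis
      by simp
  next
    case False
    have "\<bar>f (override_on y y' K) - f (override_on y y' (insert k K))\<bar> \<le> enn2real (osc B f k)"
      using y y' by (intro diff_le_osc bd) (auto simp: space_PiM PiE_iff override_on_def)
    with False show ?thesis
      by simp
  qed
  with insert.IH show ?case
    unfolding sum.insert[OF insert.hyps] by linarith
qed simp

lemma local_function_diff_le_sum_osc:
  assumes "local_function B f" "bounded_differences B f"
  obtains J where "finite J" "\<And>y y'. y \<in> space (seq_space B) \<Longrightarrow> y' \<in> space (seq_space B) \<Longrightarrow>
      \<bar>f y - f y'\<bar> \<le> (\<Sum>j\<in>J. enn2real (osc B f j) * of_bool (y j \<noteq> y' j))"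
proof -
  obtain J where J: "finite J" and loc: "\<forall>y\<in>space (seq_space B). \<forall>y'\<in>space (seq_space B).
      (\<forall>j\<in>J. y j = y' j) \<longrightarrow> f y = f y'"
    using assms(1) unfolding local_function_def by (elim exE conjE)
  have "\<bar>f y - f y'\<bar> \<le> (\<Sum>j\<in>J. enn2real (osc B f j) * of_bool (y j \<noteq> y' j))"
    if "y \<in> space (seq_space B)" "y' \<in> space (seq_space B)" for y y'
  proof -
    have "f (override_on y y' J) = f y'"
      using that by (intro loc[rule_format]) (auto simp: space_PiM PiE_iff override_on_def)
    then show ?thesis
      using diff_override_on_le_sum_osc[OF assms(2) that J] by simp
  qed
  with J show thesis by (rule that)
qed

lemma sum_osc_sq_le_osc_norm_sq:
  assumes "finite J"
  shows "(\<Sum>j\<in>J. (osc B f j)\<^sup>2) \<le> osc_norm_sq B f"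
proof -
  have "(\<Sum>j\<in>J. (osc B f j)\<^sup>2) = (\<Sum>\<^sub>\<infinity>j\<in>J. (osc B f j)\<^sup>2)"
    using assms by simp
  also have "\<dots> \<le> osc_norm_sq B f"
    unfolding osc_norm_sq_def by (rule infsum_mono_neutral) (auto intro: nonneg_summable_on_complete)
  finally show ?thesis .
qed

text \<open>\<open>nn_integral\<close> is a supremum over simple functions below the integrand, so
  completing \<open>M\<close> does not change it, even for a radius that is not measurable.\<close>

lemma mean_left_window_eq:
  assumes "space (seq_space A) = space (seq_space N)"
  shows "mean_left_window M A \<phi> X
    = (\<integral>\<^sup>+\<omega>. 2 * ennreal_of_enat (left_radius N \<phi> (\<lambda>i. X i \<omega>)) + 1 \<partial>M)"
  using assms by (simp add: mean_left_window_def left_radius_def nn_integral_completion)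

context iid_coding
begin

text \<open>A finite radius puts the sample into \<open>determined {..0} 0\<close>. This event is
  measurable, so it passes to the law \<open>P\<close>, where translation moves the origin to
  \<open>j\<close>.\<close>

lemma AE_determined_past_if_left_radius_finite:
  assumes X: "X \<in> M \<rightarrow>\<^sub>M P" "distr M P X = P" and fin: "AE \<omega> in M. left_radius N \<phi> (X \<omega>) < \<infinity>"
  shows "AE z in P. z \<in> determined {..j} j"
proof -
  have "AE \<omega> in M. X \<omega> \<in> determined {..0} 0"
    using fin AE_space
  proof eventually_elim
    case (elim \<omega>)
    then obtain r where "left_radius N \<phi> (X \<omega>) = enat r"
      by auto
    moreover have "X \<omega> \<in> space P"
      using X(1) elim(2) by (rule measurable_space)
    ultimately show ?case
      by (intro in_determined_if_left_radius_less[of _ "Suc r"]) auto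
  qed
  then have "AE z in distr M P X. z \<in> determined {..0} 0"
    by (subst AE_distr_iff) (use X in simp_all)
  then have "AE z in distr P P (translate j). z \<in> determined {..0} 0"
    unfolding distr_translate X(2) .
  then have "AE z in P. translate j z \<in> determined {..0} 0"
    by (rule AE_distrD[OF translate_measurable])
  then show ?thesis
    using AE_space
  proof eventually_elim
    case (elim z)
    have "(\<lambda>i. i + j) ` {..0} = {..j}"
      using image_add_atMost[of j 0] by (simp add: add.commute)
    then show ?case
      using elim translate_in_determined_iff[of z j "{..0}" 0] by simp
  qed
qed

text \<open>The pointwise bound is integrated. Only the indicators are transported from
  \<open>P\<close> to \<open>M\<close>; for the radius monotonicity of the integral
  suffices.\<close>

lemma sum_undetermined_prob_le:
  assumes X [measurable]: "X \<in> M \<rightarrow>\<^sub>M P" and "distr M P X = P"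
  shows "ennreal (\<Sum>k<n. undetermined_prob k)
      \<le> (\<integral>\<^sup>+\<omega>. 2 * ennreal_of_enat (left_radius N \<phi> (X \<omega>)) + 1 \<partial>M)"
proof -
  have "ennreal (\<Sum>k<n. undetermined_prob k)
      = (\<Sum>k<n. emeasure P (space P - determined {- int k<..0} 0))"
    by (simp add: undetermined_prob_def P.emeasure_eq_measure)
  also have "\<dots> = (\<integral>\<^sup>+z. (\<Sum>k<n. indicator (space P - determined {- int k<..0} 0) z) \<partial>P)"
    by (subst nn_integral_sum) auto
  also have "\<dots> = (\<integral>\<^sup>+z. (\<Sum>k<n. indicator (space P - determined {- int k<..0} 0) z) \<partial>distr M P X)"
    by (simp only: assms(2))
  also have "\<dots> = (\<integral>\<^sup>+\<omega>. (\<Sum>k<n. indicator (space P - determined {- int k<..0} 0) (X \<omega>)) \<partial>M)"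
    by (rule nn_integral_distr) measurable
  also have "\<dots> \<le> (\<integral>\<^sup>+\<omega>. 2 * ennreal_of_enat (left_radius N \<phi> (X \<omega>)) + 1 \<partial>M)"
    by (intro nn_integral_mono sum_indicator_undetermined_le measurable_space[OF X])
  finally show ?thesis .
qed

end

section \<open>Transfer to the law of the process and conclusion\<close>

theorem theorem4p7:
  fixes M :: "'w measure" and A :: "'a measure" and B :: "'b measure"
    and X :: "int \<Rightarrow> 'w \<Rightarrow> 'a" and Y :: "int \<Rightarrow> 'w \<Rightarrow> 'b"
    and \<phi> :: "(int \<Rightarrow> 'a) \<Rightarrow> int \<Rightarrow> 'b"
    and f :: "(int \<Rightarrow> 'b) \<Rightarrow> real" and t :: real
  assumes "prob_space M"
    and "standard_borel A" and "standard_borel B"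
    and "iid_process M A X"
    and "\<And>i. Y i \<in> measurable M B"
    and "left_finitary_coding M A B \<phi> X Y"
    and "f \<in> borel_measurable (seq_space B)"
    and "local_function B f"
    and "bounded_differences B f"
    and "t > 0"
  shows "ereal (ln (\<integral>\<omega>. exp (t * (f (\<lambda>i. Y i \<omega>) - (\<integral>\<omega>'. f (\<lambda>i. Y i \<omega>') \<partial>M))) \<partial>M))
       \<le> enn2ereal (3 * ennreal (t\<^sup>2) * (mean_left_window M A \<phi> X)\<^sup>2 * osc_norm_sq B f)"
proof -
  interpret M: prob_space M by fact
  note [measurable] = assms(5) assms(7)
  \<comment> \<open>\<open>A\<close> supplies only a sigma-algebra; the law \<open>N\<close> lives
    on the same one, so the coding notions carry over.\<close>
  define N where "N = distr M A (X 0)"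
  define XX where "XX = (\<lambda>\<omega> i. X i \<omega>)"
  have indep: "M.indep_vars (\<lambda>_. A) X UNIV" and ident: "\<And>i. distr M A (X i) = N"
    using assms(4) unfolding iid_process_def N_def by auto
  have X [measurable]: "X i \<in> M \<rightarrow>\<^sub>M A" for i
    using indep unfolding M.indep_vars_def by auto
  have sets_N [measurable_cong]: "sets N = sets A"
    by (simp add: N_def)
  have space_N: "space (seq_space A) = space (seq_space N)"
    by (simp add: N_def space_PiM)
  have sets_seq: "sets (seq_space N) = sets (seq_space A)"
    by (intro sets_PiM_cong refl sets_N)
  have radius: "left_radius A \<phi> = left_radius N \<phi>"
    by (auto simp: left_radius_def space_N fun_eq_iff)
  have coding: "coding_map A B \<phi>" and Y_eq: "AE \<omega> in M. (\<lambda>i. Y i \<omega>) = \<phi> (XX \<omega>)"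
    and finitary: "AE \<omega> in M. left_radius N \<phi> (XX \<omega>) < \<infinity>"
    using assms(6) unfolding left_finitary_coding_def radius XX_def by auto
  have \<phi> [measurable]: "\<phi> \<in> seq_space N \<rightarrow>\<^sub>M seq_space B"
    using coding by (simp add: coding_map_def measurable_cong_sets[OF sets_seq])
  interpret N: prob_space N
    unfolding N_def by (rule M.prob_space_distr) measurable
  interpret iid_coding N B \<phi>
  proof
    show "Measurable.pred (B \<Otimes>\<^sub>M B) (\<lambda>p. fst p = snd p)"
      using assms(3) by (rule standard_borel_pred_eq)
  qed (use \<phi> coding in \<open>auto simp: coding_map_def space_N\<close>)
  have XX [measurable]: "XX \<in> M \<rightarrow>\<^sub>M P"
    unfolding XX_def by (rule measurable_PiM_single') (auto simp: measurable_space[OF X] N_def)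
  \<comment> \<open>Independence with equal marginals means that the joint law is the product
    measure.\<close>
  have distr_XX: "distr M P XX = P"
    using indep M.indep_vars_iff_distr_eq_PiM[where I = UNIV and M' = "\<lambda>_. A" and X = X] X
    by (simp add: ident XX_def restrict_UNIV cong: distr_cong[OF refl sets_seq])
  obtain J where J: "finite J" and f_diff: "\<And>y y'. y \<in> space (seq_space B) \<Longrightarrow> y' \<in> space (seq_space B) \<Longrightarrow>
      \<bar>f y - f y'\<bar> \<le> (\<Sum>j\<in>J. enn2real (osc B f j) * of_bool (y j \<noteq> y' j))"
    using local_function_diff_le_sum_osc[OF assms(8,9)] by blast
  interpret bounded_difference_coding N B \<phi> f J "\<lambda>j. enn2real (osc B f j)"
    using AE_determined_past_if_left_radius_finite[OF XX distr_XX finitary]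
    by unfold_locales (use J f_diff in auto)
  let ?d = "\<lambda>j. enn2real (osc B f j)"
  let ?W = "mean_left_window M A \<phi> X"
  let ?mgf = "\<integral>x. exp (t * (F x - (\<integral>x. F x \<partial>P))) \<partial>P"
  have Y_to_F: "(\<integral>\<omega>. g (f (\<lambda>i. Y i \<omega>)) \<partial>M) = (\<integral>x. g (F x) \<partial>P)"
    if [measurable]: "g \<in> borel_measurable borel" for g :: "real \<Rightarrow> real"
  proof -
    have [measurable]: "(\<lambda>\<omega> i. Y i \<omega>) \<in> M \<rightarrow>\<^sub>M seq_space B"
      by (rule measurable_PiM_single') (auto simp: measurable_space[OF assms(5)])
    have "(\<integral>\<omega>. g (f (\<lambda>i. Y i \<omega>)) \<partial>M) = (\<integral>\<omega>. g (F (XX \<omega>)) \<partial>M)"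
      using Y_eq by (intro integral_cong_AE) (measurable, auto simp: F_def)
    also have "\<dots> = (\<integral>x. g (F x) \<partial>distr M P XX)"
      by (rule integral_distr[symmetric]) measurable
    finally show ?thesis
      by (simp add: distr_XX)
  qed
  have mgf: "(\<integral>\<omega>. exp (t * (f (\<lambda>i. Y i \<omega>) - (\<integral>\<omega>'. f (\<lambda>i. Y i \<omega>') \<partial>M))) \<partial>M) = ?mgf"
    using Y_to_F[of "\<lambda>s. s"] Y_to_F[of "\<lambda>s. exp (t * (s - (\<integral>x. F x \<partial>P)))"] by simp
  have osc_sum: "ennreal (\<Sum>j\<in>J. (?d j)\<^sup>2) \<le> osc_norm_sq B f"
  proof -
    \<comment> \<open>No information is lost in \<open>enn2real\<close>, because bounded differences
      make each oscillation finite.\<close>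
    have "ennreal ((?d j)\<^sup>2) = (osc B f j)\<^sup>2" for j
      using assms(9) by (simp add: bounded_differences_def ennreal_power[symmetric] less_top)
    then show ?thesis
      using sum_osc_sq_le_osc_norm_sq[OF J, of B f] by (simp add: sum_ennreal[symmetric])
  qed
  have sum_le_W: "ennreal (\<Sum>k<n. undetermined_prob k) \<le> ?W" for n
    using sum_undetermined_prob_le[OF XX distr_XX] unfolding mean_left_window_eq[OF space_N] XX_def .
  \<comment> \<open>In \<open>ennreal\<close>, infinity times zero is zero, so with vanishing
    oscillation the right side is zero even for an infinite window, and that case needs its own
    argument.\<close>
  consider "?W < \<infinity>" | "?W = \<infinity>" "osc_norm_sq B f \<noteq> 0" | "osc_norm_sq B f = 0"
    using top.not_eq_extremum[of ?W] by (auto simp: infinity_ennreal_def)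
  then show ?thesis
  proof cases
    case 1
    define Q where "Q = enn2real ?W"
    have Q: "?W = ennreal Q" "0 \<le> Q"
      using 1 by (simp_all add: Q_def less_top)
    define s where "s = (\<Sum>j\<in>J. (?d j)\<^sup>2)"
    have s: "0 \<le> s"
      unfolding s_def by (intro sum_nonneg zero_le_power2)
    have nonneg: "0 \<le> t\<^sup>2 * (Q\<^sup>2 * s)"
      using s by (intro mult_nonneg_nonneg zero_le_power2)
    have "(\<Sum>k<n. undetermined_prob k) \<le> Q" for n
      using sum_le_W[of n] Q by simp
    then have le: "?mgf \<le> exp (t\<^sup>2 * (Q\<^sup>2 * s) / 2)"
      unfolding s_def by (intro integral_exp_le_window assms(10))
    \<comment> \<open>Since \<open>ln 0 = 0\<close>, the bound also holds if the integral is zero,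
      so its positivity need not be shown.\<close>
    have "ln ?mgf \<le> t\<^sup>2 * (Q\<^sup>2 * s) / 2"
    proof (cases "?mgf = 0")
      case False
      moreover have "0 \<le> ?mgf"
        by (rule Bochner_Integration.integral_nonneg) simp
      ultimately have "0 < ?mgf"
        by linarith
      then have "ln ?mgf \<le> ln (exp (t\<^sup>2 * (Q\<^sup>2 * s) / 2))"
        using le by (subst ln_le_cancel_iff) simp_all
      then show ?thesis
        by simp
    next
      case True
      then show ?thesis
        unfolding True using nonneg by simp
    qed
    \<comment> \<open>The constant \<open>1/2\<close> is relaxed to the stated
      \<open>3\<close>.\<close>
    also have "\<dots> \<le> 3 * (t\<^sup>2 * (Q\<^sup>2 * s))"
      using nonneg by linarith
    finally have "ereal (ln ?mgf) \<le> ereal (3 * (t\<^sup>2 * (Q\<^sup>2 * s)))"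
      by simp
    also have "\<dots> = enn2ereal (ennreal (3 * (t\<^sup>2 * (Q\<^sup>2 * s))))"
      using nonneg by (subst enn2ereal_ennreal) simp_all
    also have "\<dots> \<le> enn2ereal (3 * ennreal (t\<^sup>2) * ?W\<^sup>2 * osc_norm_sq B f)"
    proof -
      have "ennreal (3 * (t\<^sup>2 * (Q\<^sup>2 * s))) = 3 * ennreal (t\<^sup>2) * ?W\<^sup>2 * ennreal s"
        using s nonneg Q(2) unfolding Q(1)
        by (simp add: ennreal_mult ennreal_power[symmetric] mult.assoc)
      also have "\<dots> \<le> 3 * ennreal (t\<^sup>2) * ?W\<^sup>2 * osc_norm_sq B f"
        unfolding s_def by (intro mult_left_mono osc_sum) simp
      finally show ?thesis
        by (simp only: less_eq_ennreal.rep_eq)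
    qed
    finally show ?thesis
      unfolding mgf .
  next
    case 2
    then have "3 * ennreal (t\<^sup>2) * ?W\<^sup>2 * osc_norm_sq B f = \<infinity>"
      using assms(10) by (simp add: ennreal_mult_eq_top_iff power2_eq_square)
    then show ?thesis
      by simp
  next
    case 3
    then have "ennreal (\<Sum>j\<in>J. (?d j)\<^sup>2) = 0"
      using osc_sum by (simp only: le_zero_eq)
    then have "(\<Sum>j\<in>J. (?d j)\<^sup>2) \<le> 0"
      by (simp only: ennreal_eq_0_iff)
    then have "(\<Sum>j\<in>J. (?d j)\<^sup>2) = 0"
      by (intro antisym sum_nonneg zero_le_power2)
    then have d: "?d j = 0" if "j \<in> J" for j
      using that J by (simp add: sum_nonneg_eq_0_iff)
    obtain x0 where x0: "x0 \<in> space P"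
      using P.not_empty by blast
    \<comment> \<open>With all oscillations on \<open>J\<close> zero, \<open>F\<close> is constant;
      the exponential moment is then \<open>1\<close> and its logarithm \<open>0\<close>.\<close>
    have const: "F x = F x0" if "x \<in> space P" for x
      using F_diff[OF that x0] d by simp
    have "(\<integral>x. F x \<partial>P) = (\<integral>x. F x0 \<partial>P)"
      by (rule Bochner_Integration.integral_cong) (auto intro: const)
    then have mean: "(\<integral>x. F x \<partial>P) = F x0"
      by (simp add: P.prob_space)
    have "?mgf = (\<integral>x. 1 \<partial>P)"
      by (rule Bochner_Integration.integral_cong) (auto simp: mean const)
    then have "?mgf = 1"
      by (simp add: P.prob_space)
    then show ?thesis
      unfolding mgf by (simp add: zero_ereal_def[symmetric])
  qed
qed

end
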